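(* Let $(p_n)_{n=1}^\infty$ be a sequence of complex polynomials such that $\deg p_1\geq 1$ and $\deg p_n\geq 2$ for $n\in\{2,3,\dots\}$. Define $\alpha:=\limsup_{n\to\infty}\frac{1}{\deg p_n}$. The following conditions are equivalent: (i) $(p_n)_{n=1}^\infty$ is a guided sequence; (ii) there exist an $r>0$ and a function $h:\mathbb{C}\to\mathbb{R}$ satisfying $h(z)-\alpha\log|z|\to\infty$ as $|z|\to\infty$ such that $\bigcup_{n=1}^\infty p_n^{-1}(0)\subset\overline{\mathbb{D}}(0,r)$ and for every $z\in\mathbb{C}\setminus\overline{\mathbb{D}}(0,r)$ there exist a neighbourhood $U$ of $z$ and an integer $N=N(U)>1$ such that $\frac{1}{\deg p_n}\log^+|p_n(\zeta)|>h(\zeta)$ for all $n\geq N$ and all $\zeta\in U$; (iii) there exists $R>1$ such that for all $n\geq 2$: $p_n^{-1}\left(\overline{\mathbb{D}}(0,R)\right)\subset\overline{\mathbb{D}}(0,R)$; (iv) for every compact and regular set $K\subset\mathbb{C}$ the sequence $(p_n)_{n=1}^\infty$ is $K$-guided with some constant $a\in(\alpha,1]$; (v) there exists a compact and regular set $K\subset\mathbb{C}$ such that $(p_n)_{n=1}^\infty$ is $K$-guided with some constant $a\in(\alpha,1]$.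
   Context: Notation: $\overline{\mathbb{D}}(a,R)=\{z\in\mathbb{C}:|z-a|\leq R\}$ and $\log^+ x=\max\{0,\log x\}$ (with $\log^+0=0$). Guided sequence: a sequence of complex polynomials $(p_n)_{n=1}^\infty$ with $\deg p_1\geq 1$ and $\deg p_n\geq 2$ for $n\geq 2$ is called guided if, with $\alpha:=\limsup_{n\to\infty}\frac{1}{\deg p_n}$, there exist an $r>0$ and a function $h:\mathbb{C}\to\mathbb{R}$ satisfying $h(z)-\alpha\log|z|\to\infty$ as $|z|\to\infty$ such that $\bigcup_{n=1}^\infty p_n^{-1}(0)\subset\overline{\mathbb{D}}(0,r)$ and there exists $N>1$ such that $\frac{1}{\deg p_n}\log^+|p_n(\zeta)|>h(\zeta)$ for all $n\geq N$ and all $\zeta\in\mathbb{C}\setminus\overline{\mathbb{D}}(0,r)$. Regular sets and Green functions: for compact $K\subset\mathbb{C}$ let $D_\infty^K$ be the unbounded component of $\mathbb{C}\setminus K$ and $\widehat K=\mathbb{C}\setminus D_\infty^K$. The Green function (with pole at infinity) of an unbounded domain $D\subset\mathbb{C}$ is, if it exists, the (unique) function $g_D:D\to\mathbb{R}$ that is harmonic and positive in $D$, satisfies $g_D(z)\to 0$ as $z\to\partial D$, and for which $g_D(z)-\log|z|$ tends to a finite number as $z\to\infty$. $K$ is regular if $g_{D_\infty^K}$ exists; then $g_K:\mathbb{C}\to\mathbb{R}$ is defined by $g_K=g_{D_\infty^K}$ on $D_\infty^K$ and $g_K=0$ on $\widehat K$. $K$-guided sequence (with no requirement that $\deg p_n=n$):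 let $K\subset\mathbb{C}$ be compact and regular. A sequence $(p_n)_{n=1}^\infty$ of non-constant polynomials is $K$-guided with constant $a>0$ if there exist $\delta>0$ and $b\in\mathbb{R}$ such that ( * ) $K\cup\bigcup_{n=1}^\infty p_n^{-1}(0)\subset\overline{\mathbb{D}}(0,\delta)$; ( ** ) for every $z\in\mathbb{C}\setminus\overline{\mathbb{D}}(0,\delta)$ there exist a neighbourhood $U$ of $z$ and $N=N(U)\geq 1$ such that $\frac{1}{\deg p_n}\log^+|p_n(\zeta)|\geq a\,g_K(\zeta)-b$ for all $n\geq N$ and all $\zeta\in U$. *)

theory Defs
  imports
    "HOL-Analysis.Analysis"
    "HOL-Computational_Algebra.Polynomial"
begin

definition log_plus :: "real \<Rightarrow> real" where
  "log_plus x = (if x = 0 then 0 else max 0 (ln x))"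

text \<open>Sequences \<open>(p\<^sub>n)\<close> are indexed from 1; the value \<open>p 0\<close> is never used.\<close>

text \<open>The limit superior is taken in the extended reals. Its terms lie in \<open>[0, 1]\<close>, so
  the conversion back to the reals loses nothing.\<close>

definition limsup_inv_degree :: "(nat \<Rightarrow> complex poly) \<Rightarrow> real" where
  "limsup_inv_degree p = real_of_ereal (limsup (\<lambda>n. ereal (1 / real (degree (p n)))))"

definition guided :: "(nat \<Rightarrow> complex poly) \<Rightarrow> bool" where
  "guided p \<longleftrightarrow>
     degree (p 1) \<ge> 1 \<and> (\<forall>n\<ge>2. degree (p n) \<ge> 2) \<and>
     (\<exists>(r::real) (h::complex \<Rightarrow> real). r > 0 \<and>
        filterlim (\<lambda>z. h z - limsup_inv_degree p * ln (cmod z)) at_top at_infinity \<and>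
        (\<Union>n\<in>{1..}. poly (p n) -` {0}) \<subseteq> cball 0 r \<and>
        (\<exists>N>1. \<forall>n\<ge>N. \<forall>\<zeta>\<in>- cball 0 r.
           1 / real (degree (p n)) * log_plus (cmod (poly (p n) \<zeta>)) > h \<zeta>))"

text \<open>\<open>u\<close> is of class \<open>C\<^sup>2\<close> on the open set \<open>D\<close> and its Laplacian vanishes there; \<open>ux\<close>, \<open>uy\<close>,
  \<open>uxx\<close>, \<dots> are the partial derivatives with respect to \<open>x = Re z\<close> and \<open>y = Im z\<close>.\<close>

definition harmonic_on :: "(complex \<Rightarrow> real) \<Rightarrow> complex set \<Rightarrow> bool" where
  "harmonic_on u D \<longleftrightarrow> open D \<and>
     (\<exists>ux uy uxx uxy uyx uyy :: complex \<Rightarrow> real.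
        (\<forall>z\<in>D.
           (u has_derivative (\<lambda>v. ux z * Re v + uy z * Im v)) (at z) \<and>
           (ux has_derivative (\<lambda>v. uxx z * Re v + uxy z * Im v)) (at z) \<and>
           (uy has_derivative (\<lambda>v. uyx z * Re v + uyy z * Im v)) (at z) \<and>
           uxx z + uyy z = 0) \<and>
        continuous_on D uxx \<and> continuous_on D uxy \<and>
        continuous_on D uyx \<and> continuous_on D uyy)"

text \<open>Only the values of \<open>g\<close> on \<open>D\<close> matter.\<close>

definition is_green_function :: "complex set \<Rightarrow> (complex \<Rightarrow> real) \<Rightarrow> bool" where
  "is_green_function D g \<longleftrightarrow>
     harmonic_on g D \<and> (\<forall>z\<in>D. g z > 0) \<and>
     (\<forall>w\<in>frontier D. (g \<longlongrightarrow> 0) (at w within D)) \<and>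
     (\<exists>c::real. ((\<lambda>z. g z - ln (cmod z)) \<longlongrightarrow> c) (inf at_infinity (principal D)))"

text \<open>The Green function of an unbounded domain \<open>D\<close>. It is unique on \<open>D\<close>, but a total function
  representing it is arbitrary off \<open>D\<close>, hence the choice operator.\<close>

definition green_function :: "complex set \<Rightarrow> complex \<Rightarrow> real" where
  "green_function D = (SOME g. is_green_function D g)"

text \<open>For compact \<open>K\<close>, the set \<open>outside K\<close> is the unbounded component of the complement of \<open>K\<close>.\<close>

definition regular_set :: "complex set \<Rightarrow> bool" where
  "regular_set K \<longleftrightarrow> (\<exists>g. is_green_function (outside K) g)"

definition green_K :: "complex set \<Rightarrow> complex \<Rightarrow> real" where
  "green_K K z = (if z \<in> outside K then green_function (outside K) z else 0)"

definition K_guided :: "complex set \<Rightarrow> (nat \<Rightarrow> complex poly) \<Rightarrow> real \<Rightarrow> bool" where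
  "K_guided K p a \<longleftrightarrow>
     a > 0 \<and> (\<forall>n\<ge>1. degree (p n) \<ge> 1) \<and>
     (\<exists>(\<delta>::real) (b::real). \<delta> > 0 \<and>
        K \<union> (\<Union>n\<in>{1..}. poly (p n) -` {0}) \<subseteq> cball 0 \<delta> \<and>
        (\<forall>z\<in>- cball 0 \<delta>. \<exists>U N. open U \<and> z \<in> U \<and> N \<ge> 1 \<and>
           (\<forall>n\<ge>N. \<forall>\<zeta>\<in>U.
              1 / real (degree (p n)) * log_plus (cmod (poly (p n) \<zeta>)) \<ge> a * green_K K \<zeta> - b)))"

end

theory Submission
  imports
    Defs
    "HOL-Computational_Algebra.Fundamental_Theorem_Algebra"
    "HOL-Real_Asymp.Real_Asymp"
begin

text \<open>
  The conditions look different, but each of them only records that the zeros of all \<open>p\<^sub>n\<close> lie in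
  one disc \<open>cball 0 r\<close> and that the \<open>p\<^sub>n\<close> are not too small outside it. The first fact gives
  control of the second: writing \<open>p\<close> as a product of linear factors, a polynomial of degree \<open>d\<close>
  whose zeros have modulus at most \<open>r\<close> satisfies
  \<open>\<bar>p z\<bar> \<ge> \<bar>p w\<bar> ((\<bar>z\<bar> - r) / (\<bar>w\<bar> + r))\<^sup>d\<close> for \<open>\<bar>z\<bar> \<ge> r\<close> (\<open>poly_growth_outside_zeros\<close>). A lower
  bound at a single point \<open>w\<close> therefore spreads to all \<open>z\<close> near infinity, at a rate
  depending only on \<open>r\<close>, \<open>w\<close> and \<open>d\<close>.

  From the local condition to an invariant disc: since \<open>\<alpha> \<ge> 0\<close>, \<open>h\<close> is positive at some \<open>w\<close>
  outside the disc, so \<open>\<bar>p\<^sub>n w\<bar> \<ge> 1\<close> for large \<open>n\<close>, and the finitely many remaining \<open>p\<^sub>n\<close> do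
  not vanish at \<open>w\<close>. As all degrees are at least 2, the values \<open>\<bar>p\<^sub>n z\<bar>\<close> then grow at least
  quadratically in \<open>\<bar>z\<bar>\<close>, uniformly in \<open>n\<close>, and exceed \<open>\<bar>z\<bar>\<close> outside a large disc
  (\<open>invariant_disc_of_bound_at_point\<close>).

  From an invariant disc to the rest: for \<open>n \<ge> 2\<close> the disc contains the zeros of \<open>p\<^sub>n\<close>, and the
  values outside it exceed 1, so spreading this bound gives \<open>log\<^sup>+ \<bar>p\<^sub>n z\<bar> / deg p\<^sub>n > log \<bar>z\<bar> - C\<close>
  (\<open>log_growth_of_invariant_disc\<close>). Because \<open>\<alpha> \<le> 1/2 < 1\<close>, the right-hand side serves as the
  function \<open>h\<close> of a guided sequence. Because \<open>g\<^sub>K z - log \<bar>z\<bar>\<close> converges at infinity, the right-hand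
  side also dominates \<open>g\<^sub>K - b\<close> for a suitable \<open>b\<close>, so the sequence is \<open>K\<close>-guided with constant 1 for every regular \<open>K\<close>.
  Conversely, if it is \<open>K\<close>-guided with constant \<open>a > \<alpha>\<close>, then \<open>h = a g\<^sub>K - b - 1\<close> satisfies the
  local condition. The closed unit disc, with Green function \<open>log \<bar>z\<bar>\<close>, shows that a regular \<open>K\<close>
  exists, which links "for every \<open>K\<close>" to "for some \<open>K\<close>".
\<close>

section \<open>Degrees and the truncated logarithm\<close>

lemma limsup_inv_degree_bounds:
  assumes "\<And>n. n \<ge> 2 \<Longrightarrow> degree (p n) \<ge> 2"
  shows "0 \<le> limsup_inv_degree p" and "limsup_inv_degree p \<le> 1 / 2"
proof -
  let ?L = "limsup (\<lambda>n. ereal (1 / real (degree (p n))))"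
  have lower: "0 \<le> ?L"
    by (rule le_Limsup) (auto intro!: always_eventually)
  have upper: "?L \<le> ereal (1 / 2)"
  proof (rule Limsup_bounded)
    show "\<forall>\<^sub>F n in sequentially. ereal (1 / real (degree (p n))) \<le> ereal (1 / 2)"
      using eventually_ge_at_top[of 2]
    proof eventually_elim
      case (elim n)
      then show ?case
        using assms[of n] by (simp add: field_simps)
    qed
  qed
  obtain l where "?L = ereal l"
    using lower upper by (cases ?L) auto
  then show "0 \<le> limsup_inv_degree p" "limsup_inv_degree p \<le> 1 / 2"
    using lower upper by (auto simp: limsup_inv_degree_def)
qed

lemma ln_le_log_plus:
  assumes "x > 0"
  shows "ln x \<le> log_plus x"
  using assms by (simp add: log_plus_def)

lemma log_plus_pos_imp_gt_1:
  assumes "log_plus x > 0" "x \<ge> 0"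
  shows "x > 1"
  using assms by (auto simp: log_plus_def max_def not_le ln_gt_zero_iff split: if_splits)

section \<open>Growth outside a disc containing the zeros\<close>

text \<open>
  Compare the factorisations of \<open>p w\<close> and \<open>p z\<close> factor by factor: for a zero \<open>\<zeta>\<close>, the triangle
  inequality gives \<open>\<bar>w - \<zeta>\<bar> \<le> \<bar>w\<bar> + r\<close> and \<open>\<bar>z - \<zeta>\<bar> \<ge> \<bar>z\<bar> - r\<close>. The bound is far from sharp, but
  its constants depend on the zeros only through \<open>r\<close>, which makes it uniform along a sequence.
\<close>

lemma poly_growth_outside_zeros:
  fixes p :: "complex poly"
  assumes zeros: "\<And>\<zeta>. poly p \<zeta> = 0 \<Longrightarrow> cmod \<zeta> \<le> r"
    and z: "r \<le> cmod z"
  shows "cmod (poly p w) * (cmod z - r) ^ degree p \<le> cmod (poly p z) * (cmod w + r) ^ degree p"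
proof -
  obtain root where p: "smult (lead_coeff p) (\<Prod>i<degree p. [:- root i, 1:]) = p"
    by (rule complex_poly_decompose')
  have eval: "poly p x = lead_coeff p * (\<Prod>i<degree p. x - root i)" for x
    by (subst (1) p [symmetric]) (simp add: poly_prod)
  have root: "cmod (root i) \<le> r" if "i < degree p" for i
  proof (rule zeros)
    show "poly p (root i) = 0"
      using that unfolding eval by (auto intro!: prod_zero)
  qed
  have "(\<Prod>i<degree p. cmod (w - root i)) \<le> (\<Prod>i<degree p. cmod w + r)"
  proof (rule prod_mono)
    fix i assume "i \<in> {..<degree p}"
    then show "0 \<le> cmod (w - root i) \<and> cmod (w - root i) \<le> cmod w + r"
      using norm_triangle_ineq4[of w "root i"] root[of i] by auto
  qed
  moreover have "(\<Prod>i<degree p. cmod z - r) \<le> (\<Prod>i<degree p. cmod (z - root i))"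
  proof (rule prod_mono)
    fix i assume "i \<in> {..<degree p}"
    then show "0 \<le> cmod z - r \<and> cmod z - r \<le> cmod (z - root i)"
      using norm_triangle_ineq2[of z "root i"] root[of i] z by auto
  qed
  moreover have "0 \<le> (\<Prod>i<degree p. cmod (w - root i))"
    by (simp add: prod_nonneg)
  ultimately have
    "(\<Prod>i<degree p. cmod (w - root i)) * (cmod z - r) ^ degree p
      \<le> (cmod w + r) ^ degree p * (\<Prod>i<degree p. cmod (z - root i))"
    using z by (intro mult_mono) auto
  then have
    "cmod (lead_coeff p) * ((\<Prod>i<degree p. cmod (w - root i)) * (cmod z - r) ^ degree p)
      \<le> cmod (lead_coeff p) * ((cmod w + r) ^ degree p * (\<Prod>i<degree p. cmod (z - root i)))"
    by (rule mult_left_mono) simp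
  then show ?thesis
    by (simp add: eval norm_mult prod_norm mult_ac)
qed

text \<open>
  Only finitely many \<open>n\<close> lie below \<open>N\<close>, and their \<open>p\<^sub>n\<close> do not vanish at \<open>w\<close>, so all
  \<open>\<bar>p\<^sub>n w\<bar>\<close> with \<open>n \<ge> 2\<close> have a common lower bound \<open>m > 0\<close>. Hence \<open>\<bar>p\<^sub>n z\<bar> \<ge> m ((\<bar>z\<bar> - r) / \<rho>)\<^sup>2\<close> as soon as the quotient is at least 1, and a
  quadratic function of \<open>\<bar>z\<bar>\<close> with positive leading coefficient eventually exceeds \<open>\<bar>z\<bar>\<close>.
\<close>

lemma invariant_disc_of_bound_at_point:
  fixes p :: "nat \<Rightarrow> complex poly"
  assumes deg: "\<And>n. n \<ge> 2 \<Longrightarrow> degree (p n) \<ge> 2"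
    and r: "r > 0"
    and zeros: "\<And>n \<zeta>. n \<ge> 2 \<Longrightarrow> poly (p n) \<zeta> = 0 \<Longrightarrow> cmod \<zeta> \<le> r"
    and w: "cmod w > r"
    and bound: "\<And>n. n \<ge> N \<Longrightarrow> cmod (poly (p n) w) \<ge> 1"
  shows "\<exists>R>1. \<forall>n\<ge>2. poly (p n) -` cball 0 R \<subseteq> cball 0 R"
proof -
  define m where "m = Min (insert 1 ((\<lambda>n. cmod (poly (p n) w)) ` {2..<N}))"
  have "m > 0"
    using zeros w unfolding m_def by (subst Min_gr_iff) fastforce+
  have m: "m \<le> cmod (poly (p n) w)" if "n \<ge> 2" for n
  proof (cases "n < N")
    case True
    then show ?thesis
      using that unfolding m_def by (intro Min_le) auto
  next
    case False
    have "m \<le> 1"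
      unfolding m_def by (intro Min_le) auto
    then show ?thesis
      using bound[of n] False by simp
  qed
  define \<rho> where "\<rho> = cmod w + r"
  have \<rho>: "\<rho> > 0"
    using r by (simp add: \<rho>_def add_nonneg_pos)
  have "filterlim (\<lambda>s::real. m * ((s - r) / \<rho>)\<^sup>2 - s) at_top at_top"
    using \<open>m > 0\<close> \<rho> by real_asymp
  then have "\<forall>\<^sub>F s in at_top. 0 < m * ((s - r) / \<rho>)\<^sup>2 - s"
    unfolding filterlim_at_top_dense by blast
  then obtain S where S: "\<And>s. s \<ge> S \<Longrightarrow> s < m * ((s - r) / \<rho>)\<^sup>2"
    by (auto simp: eventually_at_top_linorder)
  \<comment> \<open>The entry \<open>r + \<rho>\<close> makes \<open>(\<bar>z\<bar> - r) / \<rho> \<ge> 1\<close>, so that raising a degree from 2 upwards only helps.\<close>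
  define R where "R = Max {2, S, r + \<rho>}"
  have "R > 1" "R \<ge> S" "R \<ge> r + \<rho>"
    by (auto simp: R_def)
  have "R < cmod (poly (p n) z)" if n: "n \<ge> 2" and z: "cmod z > R" for n z
  proof -
    let ?q = "(cmod z - r) / \<rho>"
    have q: "?q \<ge> 1"
      using z \<open>R \<ge> r + \<rho>\<close> \<rho> by simp
    have "R < m * ?q\<^sup>2"
      using S[of "cmod z"] z \<open>R \<ge> S\<close> by simp
    also have "\<dots> \<le> m * ?q ^ degree (p n)"
      using q deg[OF n] \<open>m > 0\<close> by (intro mult_left_mono power_increasing) auto
    also have "\<dots> \<le> cmod (poly (p n) w) * ?q ^ degree (p n)"
      using q m[OF n] by (intro mult_right_mono) auto
    also have "\<dots> \<le> cmod (poly (p n) z)"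
    proof -
      have "cmod (poly (p n) w) * (cmod z - r) ^ degree (p n)
          \<le> cmod (poly (p n) z) * \<rho> ^ degree (p n)"
        unfolding \<rho>_def using zeros[OF n] z \<open>R \<ge> r + \<rho>\<close> \<rho>
        by (intro poly_growth_outside_zeros) auto
      then show ?thesis
        using \<rho> by (simp add: power_divide pos_divide_le_eq)
    qed
    finally show ?thesis .
  qed
  then have "\<forall>n\<ge>2. poly (p n) -` cball 0 R \<subseteq> cball 0 R"
    by (force simp: not_less[symmetric])
  with \<open>R > 1\<close> show ?thesis
    by blast
qed

text \<open>
  For \<open>n \<ge> 2\<close>, invariance places all zeros in \<open>cball 0 R\<close> and gives \<open>\<bar>p\<^sub>n w\<bar> > R > 1\<close> at \<open>w = R + 1\<close>; the growth
  estimate carries this value out to \<open>z\<close>. Doubling the radius ensures \<open>\<bar>z\<bar> - R \<ge> \<bar>z\<bar> / 2\<close>, so that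
  the loss is a fixed factor per degree, that is, an additive constant after taking
  \<open>log / deg p\<^sub>n\<close>. The radius \<open>\<rho>\<close> also accommodates the finitely many zeros of \<open>p 1\<close>, about which the
  invariance says nothing.
\<close>

lemma log_growth_of_invariant_disc:
  fixes p :: "nat \<Rightarrow> complex poly"
  assumes deg1: "degree (p 1) \<ge> 1"
    and deg: "\<And>n. n \<ge> 2 \<Longrightarrow> degree (p n) \<ge> 2"
    and R: "R > 1"
    and inv: "\<And>n. n \<ge> 2 \<Longrightarrow> poly (p n) -` cball 0 R \<subseteq> cball 0 R"
  obtains \<rho> C where "\<rho> > 0" "(\<Union>n\<in>{1..}. poly (p n) -` {0}) \<subseteq> cball 0 \<rho>"
    "\<And>n z. n \<ge> 2 \<Longrightarrow> cmod z > \<rho> \<Longrightarrow>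
      ln (cmod z) - C < 1 / real (degree (p n)) * log_plus (cmod (poly (p n) z))"
proof -
  have "p 1 \<noteq> 0"
    using deg1 by auto
  then have "bounded {z. poly (p 1) z = 0}"
    by (intro finite_imp_bounded poly_roots_finite)
  then obtain \<rho>1 where \<rho>1: "\<And>z. poly (p 1) z = 0 \<Longrightarrow> cmod z \<le> \<rho>1"
    by (auto simp: bounded_iff)
  define \<rho> where "\<rho> = max (2 * R) \<rho>1"
  define C where "C = ln (2 * (2 * R + 1))"
  have zeros: "cmod z \<le> R" if "n \<ge> 2" "poly (p n) z = 0" for n z
  proof -
    have "z \<in> poly (p n) -` cball 0 R"
      using that(2) R by simp
    then show ?thesis
      using inv[OF that(1)] by auto
  qed
  show ?thesis
  proof
    show "\<rho> > 0"
      using R by (simp add: \<rho>_def)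
    show "(\<Union>n\<in>{1..}. poly (p n) -` {0}) \<subseteq> cball 0 \<rho>"
    proof clarsimp
      fix n z assume n: "Suc 0 \<le> n" and z: "poly (p n) z = 0"
      show "cmod z \<le> \<rho>"
      proof (cases "n = 1")
        case True
        then show ?thesis
          using z \<rho>1[of z] by (simp add: \<rho>_def)
      next
        case False
        then show ?thesis
          using n z R zeros[of n z] by (simp add: \<rho>_def)
      qed
    qed
    fix n :: nat and z :: complex
    assume n: "n \<ge> 2" and "cmod z > \<rho>"
    then have z: "cmod z > 2 * R"
      by (simp add: \<rho>_def)
    then have "z \<noteq> 0"
      using R by auto
    define d where "d = degree (p n)"
    have d: "d > 0"
      using deg[OF n] by (simp add: d_def)
    define w where "w = complex_of_real (R + 1)"
    have w: "cmod w = R + 1"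
      using R unfolding w_def by (simp only: norm_of_real)
    have pw: "cmod (poly (p n) w) > 1"
    proof -
      have "cmod (poly (p n) w) > R"
        using inv[OF n] w by (force simp: not_le[symmetric])
      then show ?thesis
        using R by simp
    qed
    let ?q = "cmod z / (2 * (2 * R + 1))"
    have q: "?q > 0"
      using z R by (intro divide_pos_pos) auto
    have "?q ^ d * (2 * R + 1) ^ d = (cmod z / 2) ^ d"
      using R by (simp add: power_mult_distrib[symmetric] field_simps)
    also have "\<dots> \<le> (cmod z - R) ^ d"
      using z R by (intro power_mono) auto
    also have "\<dots> < cmod (poly (p n) w) * (cmod z - R) ^ d"
      using pw z R by simp
    also have "\<dots> \<le> cmod (poly (p n) z) * (2 * R + 1) ^ d"
      using poly_growth_outside_zeros[of "p n" R z w] zeros[OF n] z R w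
      by (simp add: d_def algebra_simps)
    finally have lt: "?q ^ d < cmod (poly (p n) z)"
      using R by simp
    have "real d * (ln (cmod z) - C) = ln (?q ^ d)"
      using \<open>z \<noteq> 0\<close> R q by (simp add: C_def ln_realpow ln_div)
    also have "\<dots> < ln (cmod (poly (p n) z))"
      using lt q by (subst ln_less_cancel_iff) (auto intro: less_trans[OF zero_less_power])
    also have "\<dots> \<le> log_plus (cmod (poly (p n) z))"
      by (rule ln_le_log_plus, rule less_trans[OF _ lt]) (use q in simp)
    finally show "ln (cmod z) - C < 1 / real (degree (p n)) * log_plus (cmod (poly (p n) z))"
      using d by (simp add: field_simps flip: d_def)
  qed
qed

section \<open>Green functions\<close>

lemma is_green_function_green_function:
  assumes "regular_set K"
  shows "is_green_function (outside K) (green_function (outside K))"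
  using assms unfolding regular_set_def green_function_def by (metis someI_ex)

text \<open>
  The unbounded component contains a punctured neighbourhood of infinity, so the limit in the
  definition of the Green function, taken within that component, is an unrestricted one.
\<close>

lemma green_K_minus_ln_tendsto:
  assumes "bounded K" "regular_set K"
  obtains c where "((\<lambda>z. green_K K z - ln (cmod z)) \<longlongrightarrow> c) at_infinity"
proof -
  have ev: "\<forall>\<^sub>F z in at_infinity. z \<in> outside K"
  proof -
    obtain B where "\<And>z. z \<notin> outside K \<Longrightarrow> cmod z \<le> B"
      using cobounded_outside[OF assms(1)] by (auto simp: bounded_iff)
    then show ?thesis
      unfolding eventually_at_infinity by (intro exI[of _ "B + 1"]) force
  qed
  then have le: "at_infinity \<le> inf at_infinity (principal (outside K))"
    by (simp add: le_principal)
  obtain c where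
    "((\<lambda>z. green_function (outside K) z - ln (cmod z)) \<longlongrightarrow> c)
      (inf at_infinity (principal (outside K)))"
    using is_green_function_green_function[OF assms(2)] unfolding is_green_function_def by blast
  from tendsto_mono[OF le this]
  have "((\<lambda>z. green_function (outside K) z - ln (cmod z)) \<longlongrightarrow> c) at_infinity" .
  moreover have "\<forall>\<^sub>F z in at_infinity.
      green_function (outside K) z - ln (cmod z) = green_K K z - ln (cmod z)"
    using ev by eventually_elim (simp add: green_K_def)
  ultimately show ?thesis
    using that tendsto_cong by fast
qed

text \<open>
  Locally \<open>log \<bar>z\<bar>\<close> is the real part of a branch of the logarithm, but a domain such as the
  exterior of a disc carries no branch of its own. The partial derivatives, on the other hand, are
  given globally by rational expressions in \<open>Re z\<close> and \<open>Im z\<close>.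
\<close>

lemma harmonic_on_ln_cmod:
  assumes "open D" "0 \<notin> D"
  shows "harmonic_on (\<lambda>z. ln (cmod z)) D"
proof -
  let ?s = "\<lambda>z. (Re z)\<^sup>2 + (Im z)\<^sup>2"
  have s: "?s z > 0" if "z \<in> D" for z
    using that assms(2) by (metis complex_neq_0)
  have ln_cmod: "(\<lambda>z. ln (cmod z)) = (\<lambda>z. ln (?s z) / 2)"
    by (auto simp: cmod_def ln_sqrt)
  let ?ux = "\<lambda>z. Re z / ?s z" and ?uy = "\<lambda>z. Im z / ?s z"
  let ?uxx = "\<lambda>z. ((Im z)\<^sup>2 - (Re z)\<^sup>2) / (?s z)\<^sup>2"
  let ?uxy = "\<lambda>z. - 2 * Re z * Im z / (?s z)\<^sup>2"
  let ?uyy = "\<lambda>z. ((Re z)\<^sup>2 - (Im z)\<^sup>2) / (?s z)\<^sup>2"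
  have partials: "((\<lambda>z. ln (cmod z)) has_derivative (\<lambda>v. ?ux z * Re v + ?uy z * Im v)) (at z)"
    "(?ux has_derivative (\<lambda>v. ?uxx z * Re v + ?uxy z * Im v)) (at z)"
    "(?uy has_derivative (\<lambda>v. ?uxy z * Re v + ?uyy z * Im v)) (at z)"
    "?uxx z + ?uyy z = 0"
    if "z \<in> D" for z
  proof -
    have pos: "?s z > 0"
      by (rule s[OF that])
    then have nz: "?s z \<noteq> 0"
      by linarith
    have ds: "(?s has_derivative (\<lambda>v. 2 * Re z * Re v + 2 * Im z * Im v)) (at z)"
      by (auto intro!: derivative_eq_intros)
    have "((\<lambda>z. ln (?s z) / 2) has_derivative
        (\<lambda>v. inverse (?s z) * (2 * Re z * Re v + 2 * Im z * Im v) / 2)) (at z)"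
      using pos by (auto intro!: derivative_eq_intros simp: mult_ac)
    moreover have "inverse q * (2 * a * x + 2 * b * y) / 2 = a / q * x + b / q * y"
      for q a b x y :: real
      by (cases "q = 0") (simp_all add: field_simps)
    ultimately show "((\<lambda>z. ln (cmod z)) has_derivative (\<lambda>v. ?ux z * Re v + ?uy z * Im v)) (at z)"
      unfolding ln_cmod by (simp only:)
    have quotient: "(a * ?s z - b * c) / (?s z * ?s z) = d / (?s z)\<^sup>2 * x + e / (?s z)\<^sup>2 * y"
      if "a * ?s z - b * c = d * x + e * y" for a b c d e x y :: real
      unfolding that by (simp add: add_divide_distrib power2_eq_square)
    have "(?ux has_derivative (\<lambda>v. (Re v * ?s z - Re z * (2 * Re z * Re v + 2 * Im z * Im v))
        / (?s z * ?s z))) (at z)"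
      by (intro has_derivative_divide' ds derivative_intros nz)
    moreover have "(Re v * ?s z - Re z * (2 * Re z * Re v + 2 * Im z * Im v)) / (?s z * ?s z)
        = ?uxx z * Re v + ?uxy z * Im v" for v
      by (rule quotient) (simp add: power2_eq_square algebra_simps)
    ultimately show "(?ux has_derivative (\<lambda>v. ?uxx z * Re v + ?uxy z * Im v)) (at z)"
      by (simp only:)
    have "(?uy has_derivative (\<lambda>v. (Im v * ?s z - Im z * (2 * Re z * Re v + 2 * Im z * Im v))
        / (?s z * ?s z))) (at z)"
      by (intro has_derivative_divide' ds derivative_intros nz)
    moreover have "(Im v * ?s z - Im z * (2 * Re z * Re v + 2 * Im z * Im v)) / (?s z * ?s z)
        = ?uxy z * Re v + ?uyy z * Im v" for v
      by (rule quotient) (simp add: power2_eq_square algebra_simps)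
    ultimately show "(?uy has_derivative (\<lambda>v. ?uxy z * Re v + ?uyy z * Im v)) (at z)"
      by (simp only:)
    show "?uxx z + ?uyy z = 0"
      by (simp add: add_divide_distrib[symmetric])
  qed
  have cont: "continuous_on D ?uxx" "continuous_on D ?uxy" "continuous_on D ?uyy"
    by (auto intro!: continuous_intros dest!: s)
  show ?thesis
    unfolding harmonic_on_def
    by (rule conjI[OF assms(1)], rule exI[of _ ?ux], rule exI[of _ ?uy], rule exI[of _ ?uxx],
        rule exI[of _ ?uxy], rule exI[of _ ?uxy], rule exI[of _ ?uyy])
       (intro conjI ballI partials cont)
qed

lemma regular_set_unit_disc: "regular_set (cball 0 1)"
proof -
  have out: "outside (cball 0 1) = - cball (0::complex) 1"
    by (rule outside_convex) simp
  have front: "frontier (- cball (0::complex) 1) = sphere 0 1"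
    by (simp add: frontier_complement)
  have "((\<lambda>z. ln (cmod z)) \<longlongrightarrow> 0) (at w within - cball 0 1)" if "cmod w = 1" for w
    using tendsto_ln[OF tendsto_norm[OF tendsto_ident_at], of w "- cball 0 1"] that by simp
  then have "is_green_function (- cball 0 1) (\<lambda>z. ln (cmod z))"
    unfolding is_green_function_def front
    by (auto intro!: harmonic_on_ln_cmod ln_gt_zero simp: not_le)
  then show ?thesis
    unfolding regular_set_def out by blast
qed

section \<open>Consequences of logarithmic growth\<close>

text \<open>
  Near infinity \<open>g\<^sub>K z \<le> log \<bar>z\<bar> + c + 1\<close>, where \<open>c\<close> is the limit of the difference, so logarithmic
  growth with slope 1 dominates \<open>g\<^sub>K\<close> up to a constant.
\<close>

lemma K_guided_of_log_growth:
  assumes deg1: "\<And>n. n \<ge> 1 \<Longrightarrow> degree (p n) \<ge> 1"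
    and K: "compact K" "regular_set K"
    and \<rho>: "\<rho> > 0" and zeros: "(\<Union>n\<in>{1..}. poly (p n) -` {0}) \<subseteq> cball 0 \<rho>"
    and growth: "\<And>n z. n \<ge> 2 \<Longrightarrow> cmod z > \<rho> \<Longrightarrow>
      ln (cmod z) - C < 1 / real (degree (p n)) * log_plus (cmod (poly (p n) z))"
  shows "K_guided K p 1"
proof -
  obtain c where "((\<lambda>z. green_K K z - ln (cmod z)) \<longlongrightarrow> c) at_infinity"
    using green_K_minus_ln_tendsto compact_imp_bounded K by blast
  then have "\<forall>\<^sub>F z in at_infinity. green_K K z - ln (cmod z) < c + 1"
    by (rule order_tendstoD) simp
  then obtain B where B: "\<And>z. cmod z \<ge> B \<Longrightarrow> green_K K z - ln (cmod z) < c + 1"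
    by (auto simp: eventually_at_infinity)
  obtain k where k: "\<And>z. z \<in> K \<Longrightarrow> cmod z \<le> k"
    using compact_imp_bounded[OF K(1)] by (auto simp: bounded_iff)
  define \<delta> where "\<delta> = Max {\<rho>, B, k}"
  have \<delta>: "\<delta> \<ge> \<rho>" "\<delta> \<ge> B" "\<delta> \<ge> k"
    by (auto simp: \<delta>_def)
  have "\<delta> > 0"
    using \<rho> \<delta> by simp
  moreover have "K \<union> (\<Union>n\<in>{1..}. poly (p n) -` {0}) \<subseteq> cball 0 \<delta>"
    using k zeros \<delta> by fastforce
  moreover have "1 / real (degree (p n)) * log_plus (cmod (poly (p n) \<zeta>))
      \<ge> 1 * green_K K \<zeta> - (c + 1 + C)" if "n \<ge> 2" "\<zeta> \<in> - cball 0 \<delta>" for n \<zeta>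
    using growth[OF that(1), of \<zeta>] B[of \<zeta>] that(2) \<delta> by simp
  ultimately show ?thesis
    unfolding K_guided_def using deg1
    by (intro conjI exI[of _ \<delta>] exI[of _ "c + 1 + C"] ballI
          exI[of _ "- cball 0 \<delta>"] exI[of _ 2]) auto
qed

lemma mult_ln_cmod_at_top:
  assumes "a > 0"
  shows "filterlim (\<lambda>z. a * ln (cmod z)) at_top at_infinity"
  by (intro filterlim_tendsto_pos_mult_at_top[OF tendsto_const assms]
        filterlim_compose[OF ln_at_top filterlim_norm_at_top])

text \<open>
  The function \<open>h z = ln (cmod z) - C\<close> is a witness: it outgrows \<open>\<alpha> log \<bar>z\<bar>\<close> because
  all degrees from the second on are at least 2, which forces \<open>\<alpha> \<le> 1/2\<close>.
\<close>

lemma guided_of_log_growth: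
  assumes deg1: "degree (p 1) \<ge> 1"
    and deg: "\<And>n. n \<ge> 2 \<Longrightarrow> degree (p n) \<ge> 2"
    and \<rho>: "\<rho> > 0" and zeros: "(\<Union>n\<in>{1..}. poly (p n) -` {0}) \<subseteq> cball 0 \<rho>"
    and growth: "\<And>n z. n \<ge> 2 \<Longrightarrow> cmod z > \<rho> \<Longrightarrow>
      ln (cmod z) - C < 1 / real (degree (p n)) * log_plus (cmod (poly (p n) z))"
  shows "guided p"
proof -
  define \<alpha> where "\<alpha> = limsup_inv_degree p"
  have "1 - \<alpha> > 0"
    using limsup_inv_degree_bounds(2)[where p = p, OF deg] by (simp add: \<alpha>_def)
  then have "filterlim (\<lambda>z. - C + (1 - \<alpha>) * ln (cmod z)) at_top at_infinity"
    by (intro filterlim_tendsto_add_at_top[OF tendsto_const] mult_ln_cmod_at_top)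
  then have "filterlim (\<lambda>z. (ln (cmod z) - C) - \<alpha> * ln (cmod z)) at_top at_infinity"
    by (simp add: algebra_simps)
  moreover have "\<exists>N>1. \<forall>n\<ge>N. \<forall>\<zeta>\<in>- cball 0 \<rho>.
      1 / real (degree (p n)) * log_plus (cmod (poly (p n) \<zeta>)) > ln (cmod \<zeta>) - C"
    using growth by (intro exI[of _ "2::nat"]) auto
  ultimately show ?thesis
    unfolding guided_def \<alpha>_def[symmetric] using deg1 deg \<rho> zeros
    by (intro conjI exI[of _ \<rho>] exI[of _ "\<lambda>z. ln (cmod z) - C"]) auto
qed

section \<open>Locally guided sequences\<close>

text \<open>
  The weakening of \<open>guided\<close> in which the index from which the lower bound holds may depend on the
  point, being constant only near each point. It is the meeting point of the remaining
  implications: both guided and \<open>K\<close>-guided sequences are locally guided.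
\<close>

definition locally_guided :: "(nat \<Rightarrow> complex poly) \<Rightarrow> bool" where
  "locally_guided p \<longleftrightarrow>
     (\<exists>(r::real) (h::complex \<Rightarrow> real). r > 0 \<and>
        filterlim (\<lambda>z. h z - limsup_inv_degree p * ln (cmod z)) at_top at_infinity \<and>
        (\<Union>n\<in>{1..}. poly (p n) -` {0}) \<subseteq> cball 0 r \<and>
        (\<forall>z\<in>- cball 0 r. \<exists>U N. open U \<and> z \<in> U \<and> N > 1 \<and>
          (\<forall>n\<ge>N. \<forall>\<zeta>\<in>U.
            1 / real (degree (p n)) * log_plus (cmod (poly (p n) \<zeta>)) > h \<zeta>)))"

lemma locally_guided_of_guided:
  assumes "guided p"
  shows "locally_guided p"
proof -
  obtain r h N where "r > 0"
    "filterlim (\<lambda>z. h z - limsup_inv_degree p * ln (cmod z)) at_top at_infinity"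
    "(\<Union>n\<in>{1..}. poly (p n) -` {0}) \<subseteq> cball 0 r" "N > 1"
    "\<forall>n\<ge>N. \<forall>\<zeta>\<in>- cball 0 r.
       1 / real (degree (p n)) * log_plus (cmod (poly (p n) \<zeta>)) > h \<zeta>"
    using assms unfolding guided_def by (elim exE conjE) (rule that)
  then show ?thesis
    unfolding locally_guided_def
    by (intro exI[of _ r] exI[of _ h] conjI ballI exI[of _ "- cball 0 r"] exI[of _ N])
       (simp_all add: closed_cball open_Compl)
qed

text \<open>
  One point \<open>w\<close> with \<open>h w > 0\<close> suffices, so the dependence of the index on the point does no
  harm. Such a \<open>w\<close> exists because \<open>h z\<close> eventually exceeds \<open>\<alpha> log \<bar>z\<bar>\<close>, which is nonnegative
  for \<open>\<bar>z\<bar> \<ge> 1\<close>.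
\<close>

lemma invariant_disc_of_locally_guided:
  assumes deg: "\<And>n. n \<ge> 2 \<Longrightarrow> degree (p n) \<ge> 2"
    and "locally_guided p"
  shows "\<exists>R>1. \<forall>n\<ge>2. poly (p n) -` cball 0 R \<subseteq> cball 0 R"
proof -
  define \<alpha> where "\<alpha> = limsup_inv_degree p"
  have \<alpha>: "\<alpha> \<ge> 0"
    using limsup_inv_degree_bounds(1)[where p = p, OF deg] by (simp add: \<alpha>_def)
  obtain r h where r: "r > 0"
    and h: "filterlim (\<lambda>z. h z - \<alpha> * ln (cmod z)) at_top at_infinity"
    and zeros: "(\<Union>n\<in>{1..}. poly (p n) -` {0}) \<subseteq> cball 0 r"
    and loc: "\<forall>z\<in>- cball 0 r. \<exists>U N. open U \<and> z \<in> U \<and> N > 1 \<and>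
      (\<forall>n\<ge>N. \<forall>\<zeta>\<in>U. 1 / real (degree (p n)) * log_plus (cmod (poly (p n) \<zeta>)) > h \<zeta>)"
    using assms(2) unfolding locally_guided_def \<alpha>_def[symmetric] by (elim exE conjE) (rule that)
  have "\<forall>\<^sub>F z in at_infinity. h z - \<alpha> * ln (cmod z) > 0"
    using h unfolding filterlim_at_top_dense by blast
  then obtain B where B: "\<And>z. cmod z \<ge> B \<Longrightarrow> h z - \<alpha> * ln (cmod z) > 0"
    by (auto simp: eventually_at_infinity)
  define w where "w = complex_of_real (Max {1, B, r + 1})"
  have cmod_w: "cmod w = Max {1, B, r + 1}"
    unfolding w_def norm_of_real by (rule abs_of_nonneg) (simp add: le_max_iff_disj)
  have w: "cmod w \<ge> 1" "cmod w \<ge> B" "cmod w > r"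
    unfolding cmod_w by (auto simp: less_max_iff_disj)
  have "0 \<le> \<alpha> * ln (cmod w)"
    using \<alpha> w(1) by simp
  then have "h w > 0"
    using B[OF w(2)] by simp
  obtain U N where "w \<in> U" "N > 1"
    "\<forall>n\<ge>N. \<forall>\<zeta>\<in>U. 1 / real (degree (p n)) * log_plus (cmod (poly (p n) \<zeta>)) > h \<zeta>"
    using loc w(3) by (metis ComplI mem_cball_0 not_less)
  then have N: "1 / real (degree (p n)) * log_plus (cmod (poly (p n) w)) > h w" if "n \<ge> N" for n
    using that by blast
  have "cmod (poly (p n) w) \<ge> 1" if "n \<ge> N" for n
  proof -
    have "0 < 1 / real (degree (p n)) * log_plus (cmod (poly (p n) w))"
      using N[OF that] \<open>h w > 0\<close> by simp
    then have "log_plus (cmod (poly (p n) w)) > 0"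
      by (auto simp: zero_less_divide_iff)
    then show ?thesis
      using log_plus_pos_imp_gt_1 by force
  qed
  with deg r zeros w(3) show ?thesis
    by (intro invariant_disc_of_bound_at_point[of p r w N]) fastforce+
qed

text \<open>
  The function \<open>h = a g\<^sub>K - b - 1\<close> works: \<open>h z - \<alpha> log \<bar>z\<bar>\<close> is \<open>(a - \<alpha>) log \<bar>z\<bar>\<close> plus a convergent
  term, and subtracting 1 turns the weak inequality of \<open>K\<close>-guidedness into a strict one.
\<close>

lemma locally_guided_of_K_guided:
  assumes K: "compact K" "regular_set K"
    and a: "limsup_inv_degree p < a"
    and "K_guided K p a"
  shows "locally_guided p"
proof -
  define \<alpha> where "\<alpha> = limsup_inv_degree p"
  obtain \<delta> b where \<delta>: "\<delta> > 0"
    and zeros: "K \<union> (\<Union>n\<in>{1..}. poly (p n) -` {0}) \<subseteq> cball 0 \<delta>"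
    and loc: "\<forall>z\<in>- cball 0 \<delta>. \<exists>U N. open U \<and> z \<in> U \<and> N \<ge> 1 \<and>
      (\<forall>n\<ge>N. \<forall>\<zeta>\<in>U.
        1 / real (degree (p n)) * log_plus (cmod (poly (p n) \<zeta>)) \<ge> a * green_K K \<zeta> - b)"
    using assms(4) unfolding K_guided_def by (elim exE conjE) (rule that)
  define h where "h z = a * green_K K z - b - 1" for z
  obtain c where "((\<lambda>z. green_K K z - ln (cmod z)) \<longlongrightarrow> c) at_infinity"
    using green_K_minus_ln_tendsto compact_imp_bounded K by blast
  then have "((\<lambda>z. a * (green_K K z - ln (cmod z)) - b - 1) \<longlongrightarrow> a * c - b - 1) at_infinity"
    by (intro tendsto_intros)
  then have "filterlim (\<lambda>z. (a * (green_K K z - ln (cmod z)) - b - 1) + (a - \<alpha>) * ln (cmod z))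
      at_top at_infinity"
    using a by (intro filterlim_tendsto_add_at_top mult_ln_cmod_at_top) (auto simp: \<alpha>_def)
  then have lim: "filterlim (\<lambda>z. h z - \<alpha> * ln (cmod z)) at_top at_infinity"
    by (simp add: h_def algebra_simps)
  have loc': "\<exists>U N. open U \<and> z \<in> U \<and> N > 1 \<and> (\<forall>n\<ge>N. \<forall>\<zeta>\<in>U.
      1 / real (degree (p n)) * log_plus (cmod (poly (p n) \<zeta>)) > h \<zeta>)"
    if z: "z \<in> - cball 0 \<delta>" for z
  proof -
    obtain U N where U: "open U" "z \<in> U" and ge: "\<forall>n\<ge>N. \<forall>\<zeta>\<in>U.
        1 / real (degree (p n)) * log_plus (cmod (poly (p n) \<zeta>)) \<ge> a * green_K K \<zeta> - b"
      using loc[rule_format, OF z] by (elim exE conjE) (rule that)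
    have "1 / real (degree (p n)) * log_plus (cmod (poly (p n) \<zeta>)) > h \<zeta>"
      if "n \<ge> max N 2" "\<zeta> \<in> U" for n \<zeta>
      using ge[rule_format, of n \<zeta>] that by (simp add: h_def)
    with U show ?thesis
      by (intro exI[of _ U] exI[of _ "max N 2"]) auto
  qed
  show ?thesis
    unfolding locally_guided_def using \<delta> zeros lim loc'
    by (intro exI[of _ \<delta>] exI[of _ h] conjI ballI) (auto simp: \<alpha>_def)
qed

section \<open>Equivalence of the conditions\<close>

theorem theorem2p2p8:
  fixes p :: "nat \<Rightarrow> complex poly" and \<alpha> :: real
  assumes deg1: "degree (p 1) \<ge> 1"
    and deg: "\<And>n. n \<ge> 2 \<Longrightarrow> degree (p n) \<ge> 2"
    and \<alpha>: "\<alpha> = limsup_inv_degree p"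
  shows
    "(guided p \<longleftrightarrow>
      (\<exists>(r::real) (h::complex \<Rightarrow> real). r > 0 \<and>
        filterlim (\<lambda>z. h z - \<alpha> * ln (cmod z)) at_top at_infinity \<and>
        (\<Union>n\<in>{1..}. poly (p n) -` {0}) \<subseteq> cball 0 r \<and>
        (\<forall>z\<in>- cball 0 r. \<exists>U N. open U \<and> z \<in> U \<and> N > 1 \<and>
          (\<forall>n\<ge>N. \<forall>\<zeta>\<in>U.
            1 / real (degree (p n)) * log_plus (cmod (poly (p n) \<zeta>)) > h \<zeta>))))
     \<and> (guided p \<longleftrightarrow>
      (\<exists>R::real. R > 1 \<and> (\<forall>n\<ge>2. poly (p n) -` cball 0 R \<subseteq> cball 0 R)))
     \<and> (guided p \<longleftrightarrow>
      (\<forall>K. compact K \<and> regular_set K \<longrightarrow> (\<exists>a. \<alpha> < a \<and> a \<le> 1 \<and> K_guided K p a)))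
     \<and> (guided p \<longleftrightarrow>
      (\<exists>K. compact K \<and> regular_set K \<and> (\<exists>a. \<alpha> < a \<and> a \<le> 1 \<and> K_guided K p a)))"
proof -
  let ?inv = "\<exists>R::real. R > 1 \<and> (\<forall>n\<ge>2. poly (p n) -` cball 0 R \<subseteq> cball 0 R)"
  let ?all = "\<forall>K. compact K \<and> regular_set K \<longrightarrow> (\<exists>a. \<alpha> < a \<and> a \<le> 1 \<and> K_guided K p a)"
  let ?ex = "\<exists>K. compact K \<and> regular_set K \<and> (\<exists>a. \<alpha> < a \<and> a \<le> 1 \<and> K_guided K p a)"
  have loc_inv: "locally_guided p \<Longrightarrow> ?inv"
    using invariant_disc_of_locally_guided[where p = p, OF deg] by blast
  have inv_guided: "guided p" and inv_all: "?all" if ?inv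
  proof -
    obtain R where R: "R > 1" "\<And>n. n \<ge> 2 \<Longrightarrow> poly (p n) -` cball 0 R \<subseteq> cball 0 R"
      using \<open>?inv\<close> by blast
    obtain \<rho> C where growth: "\<rho> > 0" "(\<Union>n\<in>{1..}. poly (p n) -` {0}) \<subseteq> cball 0 \<rho>"
      "\<And>n z. n \<ge> 2 \<Longrightarrow> cmod z > \<rho> \<Longrightarrow>
        ln (cmod z) - C < 1 / real (degree (p n)) * log_plus (cmod (poly (p n) z))"
      using log_growth_of_invariant_disc[where p = p, OF deg1 deg R] by blast
    show "guided p"
      using guided_of_log_growth[where p = p, OF deg1 deg growth] .
    have "degree (p n) \<ge> 1" if "n \<ge> 1" for n
      using that deg1 deg[of n] by (cases "n = 1") auto
    then have "K_guided K p 1" if "compact K" "regular_set K" for K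
      using K_guided_of_log_growth[where p = p, OF _ that growth] by blast
    moreover have "\<alpha> < 1"
      using limsup_inv_degree_bounds(2)[where p = p, OF deg] by (simp add: \<alpha>)
    ultimately show ?all
      by blast
  qed
  have all_ex: "?ex" if ?all
    using that[rule_format, OF conjI[OF compact_cball regular_set_unit_disc]]
      compact_cball regular_set_unit_disc by blast
  have ex_loc: "locally_guided p" if ?ex
    using that unfolding \<alpha> by (elim exE conjE) (rule locally_guided_of_K_guided)
  have "guided p \<longleftrightarrow> locally_guided p"
    by (rule iffI[OF locally_guided_of_guided inv_guided[OF loc_inv]])
  moreover have "guided p \<longleftrightarrow> ?inv"
    by (rule iffI[OF loc_inv[OF locally_guided_of_guided] inv_guided])
  moreover have "guided p \<longleftrightarrow> ?all"
    by (rule iffI[OF inv_all[OF loc_inv[OF locally_guided_of_guided]]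
          inv_guided[OF loc_inv[OF ex_loc[OF all_ex]]]])
  moreover have "guided p \<longleftrightarrow> ?ex"
    by (rule iffI[OF all_ex[OF inv_all[OF loc_inv[OF locally_guided_of_guided]]]
          inv_guided[OF loc_inv[OF ex_loc]]])
  ultimately show ?thesis
    unfolding locally_guided_def \<alpha>[symmetric] by (intro conjI)
qed

end
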